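(* Let $A\in\mathbb{R}^{n\times n}$ be symmetric positive definite, let $\mathcal{K}\subset\mathbb{R}^n$ be an $m$-dimensional subspace, and let $(\widetilde\lambda_1,\widetilde u_1),\dots,(\widetilde\lambda_m,\widetilde u_m)$ be the approximate (Ritz) eigenpairs of $A$ on $\mathcal K$, with $\widetilde\mu_j=1/\widetilde\lambda_j$. Let $(\lambda,u)$ denote an exact eigenpair, $Au=\lambda u$, and put $\mu=1/\lambda$. Assume the eigenpair approximation $(\widetilde\lambda_i,\widetilde u_i)$ has the property that $\widetilde\mu_i=1/\widetilde\lambda_i$ is closest to $\mu$. Let the corresponding spectral projection $E_m^{(i)}:\mathbb{R}^n\to\mathrm{span}\{\widetilde u_i\}$ be defined by $$(E_m^{(i)}w,\widetilde u_i)_A=(w,\widetilde u_i)_A\qquad\forall w\in\mathbb{R}^n.$$ Then the following error estimate holds: $$\|u-E_m^{(i)}u\|_A\le\sqrt{1+\frac{\widetilde\mu_1}{\delta_i^2}\,\eta_{\mathcal K}^2}\;\|(I-\mathcal P_{\mathcal K})u\|_A ,$$ where $$\eta_{\mathcal K}:=\sup_{\|g\|_2=1}\|(I-\mathcal P_{\mathcal K})A^{-1}g\|_A,\qquad \delta_i:=\min_{j\neq i}|\widetilde\mu_j-\mu|=\min_{j\ne i}\Big|\frac1{\widetilde\lambda_j}-\frac1\lambda\Big|.$$ Furthermore, the eigenvector approximation $\widetilde u_i$ has the following error estimate in the $L^2$-norm: $$\|u-E_m^{(i)}u\|_2\le\eta_{\mathcal K,i}\,\|u-E_m^{(i)}u\|_A,\qquad\text{where}\quad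 \eta_{\mathcal K,i}:=\Big(1+\frac{\widetilde\mu_1}{\delta_i}\Big)\eta_{\mathcal K}.$$
   Context: For $x,y\in\mathbb{R}^n$: $(x,y)=x^Ty$, $(x,y)_A=x^TAy$, $\|x\|_2=\sqrt{(x,x)}$ (called the $L^2$-norm), $\|x\|_A=\sqrt{(x,x)_A}$ (the energy norm). The projection $\mathcal P_{\mathcal K}:\mathbb{R}^n\to\mathcal K$ is the $A$-orthogonal projection: $(\mathcal P_{\mathcal K}x,y)_A=(x,y)_A$ for all $x\in\mathbb{R}^n$, $y\in\mathcal K$. The approximate (Ritz) eigenpairs on $\mathcal K$ are the pairs $(\widetilde\lambda_j,\widetilde u_j)\in\mathbb{R}\times\mathcal K$, $j=1,\dots,m$, satisfying $(A\widetilde u_j-\widetilde\lambda_j\widetilde u_j,v)=0$ for all $v\in\mathcal K$, ordered so that $\widetilde\lambda_1\le\cdots\le\widetilde\lambda_m$ and normalized so that $(\widetilde u_j,\widetilde u_l)_A$ equals $1$ if $j=l$ and $0$ otherwise. Hence $\widetilde\mu_1\ge\cdots\ge\widetilde\mu_m$. In the definition of $\delta_i$, the index $j$ ranges over $\{1,\dots,m\}\setminus\{i\}$. *)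

theory Defs
  imports "HOL-Analysis.Analysis"
begin

definition spd_matrix :: "real^'n^'n \<Rightarrow> bool" where
  "spd_matrix A \<longleftrightarrow> transpose A = A \<and> (\<forall>x. x \<noteq> 0 \<longrightarrow> 0 < x \<bullet> (A *v x))"

definition A_inner :: "real^'n^'n \<Rightarrow> real^'n \<Rightarrow> real^'n \<Rightarrow> real" where
  "A_inner A x y = x \<bullet> (A *v y)"

definition A_norm :: "real^'n^'n \<Rightarrow> real^'n \<Rightarrow> real" where
  "A_norm A x = sqrt (A_inner A x x)"

definition eigenpair :: "real^'n^'n \<Rightarrow> real \<Rightarrow> real^'n \<Rightarrow> bool" where
  "eigenpair A l u \<longleftrightarrow> u \<noteq> 0 \<and> A *v u = l *\<^sub>R u"

text \<open>For \<open>A\<close> symmetric positive definite and \<open>K\<close> a subspace there is exactly one such \<open>P\<close>.\<close>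

definition A_orthogonal_projection ::
    "real^'n^'n \<Rightarrow> (real^'n) set \<Rightarrow> (real^'n \<Rightarrow> real^'n) \<Rightarrow> bool" where
  "A_orthogonal_projection A K P \<longleftrightarrow>
     (\<forall>x. P x \<in> K \<and> (\<forall>y\<in>K. A_inner A (P x) y = A_inner A x y))"

definition ritz_pairs ::
    "real^'n^'n \<Rightarrow> (real^'n) set \<Rightarrow> nat \<Rightarrow> (nat \<Rightarrow> real) \<Rightarrow> (nat \<Rightarrow> real^'n) \<Rightarrow> bool" where
  "ritz_pairs A K m lt ut \<longleftrightarrow>
     (\<forall>j\<in>{1..m}. ut j \<in> K \<and> (\<forall>v\<in>K. (A *v ut j - lt j *\<^sub>R ut j) \<bullet> v = 0)) \<and>
     mono_on {1..m} lt \<and>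
     (\<forall>j\<in>{1..m}. \<forall>l\<in>{1..m}. A_inner A (ut j) (ut l) = (if j = l then 1 else 0))"

definition ritz_spectral_projection ::
    "real^'n^'n \<Rightarrow> real^'n \<Rightarrow> (real^'n \<Rightarrow> real^'n) \<Rightarrow> bool" where
  "ritz_spectral_projection A v E \<longleftrightarrow>
     (\<forall>w. E w \<in> span {v} \<and> A_inner A (E w) v = A_inner A w v)"

definition eta :: "real^'n^'n \<Rightarrow> (real^'n \<Rightarrow> real^'n) \<Rightarrow> real" where
  "eta A P = (SUP g\<in>{g. norm g = 1}. A_norm A (matrix_inv A *v g - P (matrix_inv A *v g)))"

text \<open>The minimum over \<open>j \<noteq> i\<close> is extended-real valued because the index set is empty for
  \<open>m = 1\<close>; then the gap is \<open>\<infinity>\<close>, and quotients by it are \<open>0\<close>.\<close>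

definition gap :: "(nat \<Rightarrow> real) \<Rightarrow> nat \<Rightarrow> nat \<Rightarrow> real \<Rightarrow> ereal" where
  "gap lt m i l = (INF j\<in>{1..m} - {i}. ereal \<bar>1 / lt j - 1 / l\<bar>)"

end

theory Submission
  imports Defs
begin

text \<open>
  Write \<open>e = u - P u\<close> for the best-approximation error and \<open>r = P u - E u\<close> for its complement, so
  that \<open>u - E u = e + r\<close> is an \<open>A\<close>-orthogonal splitting. Everything rests on two facts.

  The first is the duality (Aubin--Nitsche) inequality \<open>\<parallel>e\<parallel>\<^sub>2 \<le> \<eta> \<parallel>e\<parallel>\<^sub>A\<close>: test \<open>e\<close> against \<open>g = e\<close>, write
  \<open>(e, g) = (e, A\<inverse> g)\<^sub>A\<close>, and subtract the projection of \<open>A\<inverse> g\<close>, which costs nothing because \<open>e\<close> is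
  \<open>A\<close>-orthogonal to \<open>K\<close>.

  The second is that \<open>r\<close> is controlled by \<open>e\<close> alone. The Ritz vectors \<open>v\<^sub>j\<close> form an \<open>A\<close>-orthonormal basis
  of \<open>K\<close>, so \<open>r\<close> is the sum of \<open>c\<^sub>j v\<^sub>j\<close> over \<open>j \<noteq> i\<close> with \<open>c\<^sub>j = (u, v\<^sub>j)\<^sub>A\<close>. Evaluating \<open>(u, v\<^sub>j)\<close> once
  by the exact eigenvalue equation and once by the Ritz equation gives
  \<open>(\<mu> - \<mu>\<^sub>j) c\<^sub>j = (e, v\<^sub>j)\<close>, where \<open>\<mu>\<^sub>j\<close> is the reciprocal Ritz value. For \<open>j \<noteq> i\<close> the
  factor is at least the gap in modulus. The \<open>v\<^sub>j\<close> are also orthogonal in the Euclidean inner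
  product, with \<open>\<parallel>v\<^sub>j\<parallel>\<^sub>2\<^sup>2 = \<mu>\<^sub>j \<le> \<mu>\<^sub>1\<close>, so a Bessel inequality bounds the sum of the \<open>(e, v\<^sub>j)\<^sup>2\<close> by
  \<open>\<mu>\<^sub>1 \<parallel>e\<parallel>\<^sub>2\<^sup>2\<close>. This bounds \<open>\<parallel>r\<parallel>\<^sub>A\<close>, and by \<open>\<parallel>r\<parallel>\<^sub>2\<^sup>2 \<le> \<mu>\<^sub>1 \<parallel>r\<parallel>\<^sub>A\<^sup>2\<close> also \<open>\<parallel>r\<parallel>\<^sub>2\<close>. Pythagoras in the
  energy norm then gives the first estimate and the triangle inequality in the Euclidean norm the
  second.
\<close>

section \<open>The energy inner product\<close>

lemma A_inner_add_left: "A_inner A (x + y) z = A_inner A x z + A_inner A y z"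
  and A_inner_diff_left: "A_inner A (x - y) z = A_inner A x z - A_inner A y z"
  and A_inner_scale_left: "A_inner A (c *\<^sub>R x) z = c * A_inner A x z"
  and A_inner_sum_left: "A_inner A (\<Sum>j\<in>J. f j) z = (\<Sum>j\<in>J. A_inner A (f j) z)"
  by (simp_all add: A_inner_def inner_add_left inner_diff_left inner_sum_left)

lemma A_inner_commute:
  assumes "spd_matrix A"
  shows "A_inner A x y = A_inner A y x"
  using assms unfolding A_inner_def spd_matrix_def
  by (metis dot_lmul_matrix inner_commute transpose_matrix_vector)

lemma A_inner_nonneg: "spd_matrix A \<Longrightarrow> 0 \<le> A_inner A x x"
  by (cases "x = 0") (auto simp: A_inner_def spd_matrix_def less_imp_le)

lemma A_inner_eq_0_iff: "spd_matrix A \<Longrightarrow> A_inner A x x = 0 \<longleftrightarrow> x = 0"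
  by (cases "x = 0") (auto simp: A_inner_def spd_matrix_def less_le)

lemma A_norm_nonneg: "spd_matrix A \<Longrightarrow> 0 \<le> A_norm A x"
  by (simp add: A_norm_def A_inner_nonneg)

lemma A_norm_sq: "spd_matrix A \<Longrightarrow> (A_norm A x)\<^sup>2 = A_inner A x x"
  by (simp add: A_norm_def A_inner_nonneg)

lemma A_pythagoras:
  assumes "spd_matrix A" "A_inner A x y = 0"
  shows "(A_norm A (x + y))\<^sup>2 = (A_norm A x)\<^sup>2 + (A_norm A y)\<^sup>2"
proof -
  have "A_inner A z (x + y) = A_inner A x z + A_inner A y z" for z
    by (metis A_inner_add_left A_inner_commute[OF assms(1)])
  then show ?thesis
    using assms A_inner_commute[OF assms(1), of x y] by (simp add: A_norm_sq A_inner_add_left)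
qed

lemma A_norm_le_add_orthogonal:
  assumes "spd_matrix A" "A_inner A x y = 0"
  shows "A_norm A x \<le> A_norm A (x + y)"
  by (rule power2_le_imp_le) (simp_all add: A_pythagoras assms A_norm_nonneg)

lemma A_Cauchy_Schwarz:
  assumes "spd_matrix A"
  shows "A_inner A x y \<le> A_norm A x * A_norm A y"
proof (cases "y = 0")
  case True
  then show ?thesis by (simp add: A_inner_def A_norm_def)
next
  case False
  define t where "t = A_inner A x y / A_inner A y y"
  define d where "d = x - t *\<^sub>R y"
  have y: "A_inner A y y \<noteq> 0"
    using False by (simp add: A_inner_eq_0_iff assms)
  have "A_inner A d y = 0"
    using y by (simp add: d_def t_def A_inner_diff_left A_inner_scale_left)
  then have "A_inner A (t *\<^sub>R y) d = 0"
    by (metis A_inner_commute[OF assms] A_inner_scale_left mult_zero_right)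
  then have "A_norm A (t *\<^sub>R y) \<le> A_norm A x"
    using A_norm_le_add_orthogonal[OF assms] by (fastforce simp: d_def)
  moreover have "A_norm A (t *\<^sub>R y) = \<bar>t\<bar> * A_norm A y"
    by (simp add: A_norm_def A_inner_def matrix_vector_mult_scaleR real_sqrt_mult flip: mult.assoc)
  ultimately have "\<bar>t\<bar> * A_norm A y * A_norm A y \<le> A_norm A x * A_norm A y"
    by (intro mult_right_mono) (simp_all add: A_norm_nonneg assms)
  moreover have "\<bar>t\<bar> * A_norm A y * A_norm A y = \<bar>A_inner A x y\<bar>"
    using y A_inner_nonneg[OF assms, of y] A_norm_sq[OF assms, of y]
    by (simp add: t_def power2_eq_square mult.assoc)
  ultimately show ?thesis by linarith
qed

lemma spd_matrix_inv_right:
  assumes "spd_matrix A"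
  shows "A *v (matrix_inv A *v g) = g"
proof -
  have "A *v x = 0 \<Longrightarrow> x = 0" for x
    using assms unfolding spd_matrix_def by force
  then have "invertible A"
    by (metis invertible_left_inverse matrix_left_invertible_ker)
  then have "A ** matrix_inv A = mat 1"
    unfolding invertible_def matrix_inv_def by (rule someI2_ex) simp
  then show ?thesis
    by (simp add: matrix_vector_mul_assoc)
qed

section \<open>Duality for the energy projection\<close>

lemma A_projection_error_orthogonal:
  assumes "A_orthogonal_projection A K P" "y \<in> K"
  shows "A_inner A (x - P x) y = 0"
  using assms by (simp add: A_orthogonal_projection_def A_inner_diff_left)

text \<open>The supremum in \<^const>\<open>eta\<close> is a genuine one: the projection error is no longer than the
  projected vector, and \<open>\<parallel>A\<inverse> g\<parallel>\<^sub>A\<^sup>2 = (A\<inverse> g, g)\<close> is bounded on the unit sphere.\<close>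

lemma projection_error_le_eta:
  assumes A: "spd_matrix A" and P: "A_orthogonal_projection A K P" and g: "norm g = 1"
  shows "A_norm A (matrix_inv A *v g - P (matrix_inv A *v g)) \<le> eta A P"
proof -
  obtain B where B: "\<And>x. norm (matrix_inv A *v x) \<le> norm x * B"
    using bounded_linear.bounded[OF matrix_vector_mul_bounded_linear] by blast
  have "A_norm A (matrix_inv A *v h - P (matrix_inv A *v h)) \<le> sqrt B" if h: "norm h = 1" for h
  proof -
    let ?x = "matrix_inv A *v h"
    have "A_inner A (?x - P ?x) (P ?x) = 0"
      using P by (simp add: A_projection_error_orthogonal A_orthogonal_projection_def)
    then have "A_norm A (?x - P ?x) \<le> A_norm A ?x"
      using A_norm_le_add_orthogonal[OF A] by fastforce
    also have "\<dots> \<le> sqrt B"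
      using norm_cauchy_schwarz[of ?x h] B[of h] h
      by (simp add: A_norm_def A_inner_def spd_matrix_inv_right A)
    finally show ?thesis .
  qed
  then have "bdd_above ((\<lambda>g. A_norm A (matrix_inv A *v g - P (matrix_inv A *v g))) ` {g. norm g = 1})"
    by (intro bdd_aboveI2) auto
  then show ?thesis
    unfolding eta_def using g by (intro cSUP_upper) auto
qed

lemma eta_nonneg:
  assumes "spd_matrix A" "A_orthogonal_projection A K P"
  shows "0 \<le> eta A P"
proof -
  obtain g :: "real^'a" where "norm g = 1"
    using vector_choose_size[of 1] by auto
  then show ?thesis
    using projection_error_le_eta[OF assms] A_norm_nonneg[OF assms(1)] order_trans by blast
qed

text \<open>The Aubin--Nitsche argument: since the error is \<open>A\<close>-orthogonal to \<open>K\<close>, its Euclidean length,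
  tested against its own direction \<open>g\<close>, only sees the part of \<open>A\<inverse> g\<close> not captured by \<open>K\<close>.\<close>

lemma Aubin_Nitsche:
  assumes A: "spd_matrix A" and P: "A_orthogonal_projection A K P"
  shows "norm (x - P x) \<le> eta A P * A_norm A (x - P x)"
proof (cases "x - P x = 0")
  case True
  then show ?thesis by (simp add: A_norm_nonneg A eta_nonneg[OF A P])
next
  case False
  define e where "e = x - P x"
  define g where "g = sgn e"
  define w where "w = matrix_inv A *v g"
  have g: "norm g = 1" "e \<bullet> g = norm e"
    using False by (simp_all add: g_def e_def norm_sgn sgn_div_norm norm_eq_sqrt_inner
      real_div_sqrt flip: divide_inverse_commute)
  have "norm e = A_inner A e w"
    using g by (simp add: A_inner_def w_def spd_matrix_inv_right A)
  also have "\<dots> = A_inner A e (w - P w)"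
  proof -
    have "A_inner A (P w) e = 0"
      using A_projection_error_orthogonal[OF P, of "P w" x] P A_inner_commute[OF A]
      by (simp add: A_orthogonal_projection_def e_def)
    then show ?thesis
      by (simp add: A_inner_commute[OF A, of e] A_inner_diff_left)
  qed
  also have "\<dots> \<le> A_norm A e * A_norm A (w - P w)"
    by (rule A_Cauchy_Schwarz[OF A])
  also have "\<dots> \<le> A_norm A e * eta A P"
    using projection_error_le_eta[OF A P g(1)]
    by (intro mult_left_mono) (simp_all add: w_def A_norm_nonneg A)
  finally show ?thesis
    by (simp add: e_def mult.commute)
qed

section \<open>Orthogonal systems of bounded length\<close>

lemma norm_orthogonal_sum_sq:
  fixes f :: "'b \<Rightarrow> 'a::real_inner"
  assumes J: "finite J" and orth: "\<And>j k. j \<in> J \<Longrightarrow> k \<in> J \<Longrightarrow> j \<noteq> k \<Longrightarrow> f j \<bullet> f k = 0"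
  shows "(norm (\<Sum>j\<in>J. c j *\<^sub>R f j))\<^sup>2 = (\<Sum>j\<in>J. (c j)\<^sup>2 * (norm (f j))\<^sup>2)"
proof -
  have "(norm (\<Sum>j\<in>J. c j *\<^sub>R f j))\<^sup>2 = (\<Sum>j\<in>J. (norm (c j *\<^sub>R f j))\<^sup>2)"
    by (rule norm_sum_Pythagorean[OF J]) (auto simp: pairwise_def orthogonal_def orth)
  then show ?thesis by (simp add: power_mult_distrib)
qed

lemma norm_orthogonal_sum_sq_le:
  fixes f :: "'b \<Rightarrow> 'a::real_inner"
  assumes "finite J" "\<And>j k. j \<in> J \<Longrightarrow> k \<in> J \<Longrightarrow> j \<noteq> k \<Longrightarrow> f j \<bullet> f k = 0"
    and "\<And>j. j \<in> J \<Longrightarrow> (norm (f j))\<^sup>2 \<le> b"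
  shows "(norm (\<Sum>j\<in>J. c j *\<^sub>R f j))\<^sup>2 \<le> b * (\<Sum>j\<in>J. (c j)\<^sup>2)"
proof -
  have "(norm (\<Sum>j\<in>J. c j *\<^sub>R f j))\<^sup>2 = (\<Sum>j\<in>J. (c j)\<^sup>2 * (norm (f j))\<^sup>2)"
    using assms(1,2) by (rule norm_orthogonal_sum_sq)
  also have "\<dots> \<le> (\<Sum>j\<in>J. (c j)\<^sup>2 * b)"
    using assms(3) by (intro sum_mono mult_left_mono) simp_all
  finally show ?thesis
    by (simp add: sum_distrib_left mult.commute)
qed

text \<open>Bessel's inequality for unnormalized vectors. With \<open>s\<close> the sum of the \<open>(x, f\<^sub>j) f\<^sub>j\<close>, the left-hand
  side is \<open>(x, s) \<le> \<parallel>x\<parallel> \<parallel>s\<parallel>\<close>, while \<open>\<parallel>s\<parallel>\<^sup>2\<close> is at most \<open>b\<close> times the left-hand side, so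
  one factor of it cancels.\<close>

lemma Bessel_bounded_length:
  fixes f :: "'b \<Rightarrow> 'a::real_inner"
  assumes "finite J" "\<And>j k. j \<in> J \<Longrightarrow> k \<in> J \<Longrightarrow> j \<noteq> k \<Longrightarrow> f j \<bullet> f k = 0"
    and "\<And>j. j \<in> J \<Longrightarrow> (norm (f j))\<^sup>2 \<le> b" and "0 \<le> b"
  shows "(\<Sum>j\<in>J. (x \<bullet> f j)\<^sup>2) \<le> b * (norm x)\<^sup>2"
proof -
  define s where "s = (\<Sum>j\<in>J. (x \<bullet> f j) *\<^sub>R f j)"
  define S where "S = (\<Sum>j\<in>J. (x \<bullet> f j)\<^sup>2)"
  have "S = x \<bullet> s"
    by (simp add: S_def s_def inner_sum_right power2_eq_square)
  then have "S\<^sup>2 \<le> (norm x)\<^sup>2 * (norm s)\<^sup>2"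
    using Cauchy_Schwarz_ineq[of x s] by (simp add: power2_norm_eq_inner)
  also have "\<dots> \<le> (norm x)\<^sup>2 * (b * S)"
    unfolding s_def S_def using assms by (intro mult_left_mono norm_orthogonal_sum_sq_le) auto
  finally have "S * S \<le> S * (b * (norm x)\<^sup>2)"
    by (simp add: power2_eq_square mult_ac)
  moreover have "0 \<le> S"
    by (simp add: S_def sum_nonneg)
  ultimately have "S \<le> b * (norm x)\<^sup>2"
    using \<open>0 \<le> b\<close> by (cases "S = 0") auto
  then show ?thesis by (simp add: S_def)
qed

section \<open>Ritz vectors\<close>

lemma A_inner_span_eq_0:
  assumes "x \<in> span S" "\<And>y. y \<in> S \<Longrightarrow> A_inner A y z = 0"
  shows "A_inner A x z = 0"
  using assms(1)
proof (induction rule: span_induct_alt)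
  case base
  then show ?case by (simp add: A_inner_def)
next
  case (step c y w)
  then show ?case using assms(2) by (simp add: A_inner_add_left A_inner_scale_left)
qed

text \<open>An \<open>A\<close>-orthonormal family is linearly independent, so \<open>dim K\<close> many of its members span \<open>K\<close>;
  the remainder of the expansion is then \<open>A\<close>-orthogonal to itself.\<close>

lemma A_orthonormal_expansion:
  fixes v :: "nat \<Rightarrow> real^'n"
  assumes A: "spd_matrix A" and K: "subspace K" "dim K = card J" and J: "finite J"
    and v: "\<And>j. j \<in> J \<Longrightarrow> v j \<in> K"
    and on: "\<And>j l. j \<in> J \<Longrightarrow> l \<in> J \<Longrightarrow> A_inner A (v j) (v l) = (if j = l then 1 else 0)"
    and x: "x \<in> K"
  shows "x = (\<Sum>j\<in>J. A_inner A x (v j) *\<^sub>R v j)"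
proof -
  have inj: "inj_on v J"
    by (rule inj_onI) (metis on zero_neq_one)
  have "independent (v ` J)"
    unfolding dependent_def
  proof clarify
    fix j assume j: "j \<in> J" and dep: "v j \<in> span (v ` J - {v j})"
    have "A_inner A (v j) (v j) = 0"
      using dep by (rule A_inner_span_eq_0) (use j on in auto)
    then show False using on[OF j j] by simp
  qed
  moreover have "card (v ` J) = dim K"
    using inj K by (simp add: card_image)
  ultimately have span: "K \<subseteq> span (v ` J)"
    using v J by (intro card_ge_dim_independent) auto
  define r where "r = x - (\<Sum>j\<in>J. A_inner A x (v j) *\<^sub>R v j)"
  have ort: "A_inner A r (v l) = 0" if "l \<in> J" for l
  proof -
    have "(\<Sum>j\<in>J. A_inner A x (v j) * A_inner A (v j) (v l))
        = (\<Sum>j\<in>J. if j = l then A_inner A x (v j) else 0)"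
      using that on by (intro sum.cong) auto
    then show ?thesis
      using that J
      by (simp add: r_def A_inner_diff_left A_inner_sum_left A_inner_scale_left)
  qed
  have "r \<in> K"
    unfolding r_def using K v x
    by (intro subspace_diff subspace_sum subspace_scale) auto
  then have "A_inner A r r = 0"
    using span ort A_inner_commute[OF A, of _ r] by (intro A_inner_span_eq_0[of r "v ` J"]) auto
  then show ?thesis
    by (simp add: A_inner_eq_0_iff A r_def)
qed

lemma ritz_pairs_equation:
  assumes R: "ritz_pairs A K m lt ut" and j: "j \<in> {1..m}" and v: "v \<in> K"
  shows "A_inner A v (ut j) = lt j * (v \<bullet> ut j)"
proof -
  have "(A *v ut j - lt j *\<^sub>R ut j) \<bullet> v = 0"
    using R j v by (simp add: ritz_pairs_def)
  then show ?thesis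
    by (simp add: A_inner_def inner_diff_left inner_commute[of v])
qed

lemma ritz_value_pos:
  assumes R: "ritz_pairs A K m lt ut" and j: "j \<in> {1..m}"
  shows "0 < lt j"
proof -
  have "1 = lt j * (norm (ut j))\<^sup>2"
    using ritz_pairs_equation[OF R j, of "ut j"] R j
    by (simp add: ritz_pairs_def power2_norm_eq_inner)
  then show ?thesis
    by (smt (verit) mult_nonpos_nonneg zero_le_power2)
qed

lemma ritz_vectors_inner:
  assumes R: "ritz_pairs A K m lt ut" and j: "j \<in> {1..m}" "k \<in> {1..m}"
  shows "ut j \<bullet> ut k = (if j = k then 1 / lt j else 0)"
  using ritz_pairs_equation[OF R j(2), of "ut j"] ritz_value_pos[OF R j(2)] R j
  by (auto simp: ritz_pairs_def field_simps split: if_splits)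

lemma ritz_vector_length_le:
  assumes R: "ritz_pairs A K m lt ut" and j: "j \<in> {1..m}"
  shows "(norm (ut j))\<^sup>2 \<le> 1 / lt 1"
proof -
  have "lt 1 \<le> lt j"
    using R j by (auto simp: ritz_pairs_def mono_on_def)
  then show ?thesis
    using j ritz_value_pos[OF R, of 1]
    by (simp add: power2_norm_eq_inner ritz_vectors_inner[OF R] frac_le)
qed

lemma eigenvalue_pos:
  assumes "spd_matrix A" "eigenpair A lam u"
  shows "0 < lam"
proof -
  have "0 < lam * (u \<bullet> u)"
    using assms unfolding spd_matrix_def eigenpair_def by (metis inner_scaleR_right)
  then show ?thesis
    by (smt (verit) inner_ge_zero mult_nonpos_nonneg)
qed

text \<open>Both sides come from \<open>(u, v\<^sub>j)\<close>: the exact eigenvalue equation makes it \<open>(u, v\<^sub>j)\<^sub>A / \<lambda>\<close>, and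
  splitting \<open>u\<close> into its projection and the error makes it the right-hand side plus
  \<open>(u, v\<^sub>j)\<^sub>A\<close> divided by the Ritz value.\<close>

lemma ritz_coefficient_identity:
  assumes A: "spd_matrix A" and R: "ritz_pairs A K m lt ut" and u: "eigenpair A lam u"
    and P: "A_orthogonal_projection A K P" and j: "j \<in> {1..m}"
  shows "(1 / lam - 1 / lt j) * A_inner A u (ut j) = (u - P u) \<bullet> ut j"
proof -
  have K: "ut j \<in> K" "P u \<in> K"
    using R j P by (auto simp: ritz_pairs_def A_orthogonal_projection_def)
  have "A_inner A u (ut j) = lam * (u \<bullet> ut j)"
    using u A_inner_commute[OF A, of u] by (simp add: eigenpair_def A_inner_def inner_commute)
  moreover have "A_inner A u (ut j) = lt j * (P u \<bullet> ut j)"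
    using ritz_pairs_equation[OF R j K(2)] P K
    by (simp add: A_orthogonal_projection_def)
  ultimately have "A_inner A u (ut j) / lam = u \<bullet> ut j" "A_inner A u (ut j) / lt j = P u \<bullet> ut j"
    using eigenvalue_pos[OF A u] ritz_value_pos[OF R j] by (simp_all add: field_simps)
  then show ?thesis
    by (simp add: left_diff_distrib inner_diff_left)
qed

text \<open>The remaining Ritz components of an eigenvector. The number \<open>q\<close> stands for the reciprocal of
  the gap; in this form a one-dimensional \<open>K\<close> is covered with \<open>q = 0\<close>.\<close>

lemma ritz_remainder_bounds:
  assumes A: "spd_matrix A" and K: "subspace K" "dim K = m" and R: "ritz_pairs A K m lt ut"
    and u: "eigenpair A lam u" and i: "i \<in> {1..m}"
    and P: "A_orthogonal_projection A K P" and E: "ritz_spectral_projection A (ut i) E"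
    and q: "0 \<le> q" "\<And>j. j \<in> {1..m} - {i} \<Longrightarrow> 1 \<le> q * \<bar>1 / lt j - 1 / lam\<bar>"
  shows "(A_norm A (P u - E u))\<^sup>2 \<le> 1 / lt 1 * q\<^sup>2 * (norm (u - P u))\<^sup>2"
    and "norm (P u - E u) \<le> 1 / lt 1 * q * norm (u - P u)"
proof -
  define J where "J = {1..m} - {i}"
  define c where "c j = A_inner A u (ut j)" for j
  define r where "r = P u - E u"
  have on: "A_inner A (ut j) (ut l) = (if j = l then 1 else 0)" if "j \<in> {1..m}" "l \<in> {1..m}" for j l
    using R that by (simp add: ritz_pairs_def)
  have utK: "ut j \<in> K" if "j \<in> {1..m}" for j
    using R that by (simp add: ritz_pairs_def)
  have PuK: "P u \<in> K" and Pu: "A_inner A (P u) (ut j) = c j" if "j \<in> {1..m}" for j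
    using P utK[OF that] by (simp_all add: A_orthogonal_projection_def c_def)
  have "E u = c i *\<^sub>R ut i"
  proof -
    obtain k where "E u = k *\<^sub>R ut i"
      using E by (auto simp: ritz_spectral_projection_def span_singleton)
    moreover have "A_inner A (E u) (ut i) = c i"
      using E by (simp add: ritz_spectral_projection_def c_def)
    ultimately show ?thesis
      using on[OF i i] by (simp add: A_inner_scale_left)
  qed
  moreover have "P u = (\<Sum>j\<in>{1..m}. c j *\<^sub>R ut j)"
    using A_orthonormal_expansion[OF A, of K "{1..m}" ut "P u"] K on utK PuK[OF i] Pu by simp
  ultimately have r: "r = (\<Sum>j\<in>J. c j *\<^sub>R ut j)"
    using i by (simp add: r_def J_def sum.remove)
  have orth: "ut j \<bullet> ut k = 0" if "j \<in> J" "k \<in> J" "j \<noteq> k" for j k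
    using ritz_vectors_inner[OF R, of j k] that by (simp add: J_def)
  have len: "(norm (ut j))\<^sup>2 \<le> 1 / lt 1" if "j \<in> J" for j
    using ritz_vector_length_le[OF R, of j] that by (simp add: J_def)
  have mu: "0 \<le> 1 / lt 1"
    using i ritz_value_pos[OF R, of 1] by simp
  have "A_inner A r r = (\<Sum>j\<in>J. (c j)\<^sup>2)"
  proof -
    have "A_inner A r (ut j) = c j" if "j \<in> J" for j
    proof -
      have "A_inner A (E u) (ut j) = 0"
        using that i on \<open>E u = c i *\<^sub>R ut i\<close> by (simp add: A_inner_scale_left J_def)
      then show ?thesis
        using that Pu by (simp add: r_def A_inner_diff_left J_def)
    qed
    then have "(\<Sum>j\<in>J. c j * A_inner A (ut j) r) = (\<Sum>j\<in>J. (c j)\<^sup>2)"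
      by (intro sum.cong) (simp_all add: A_inner_commute[OF A, of _ r] power2_eq_square)
    then show ?thesis
      by (subst r) (simp add: A_inner_sum_left A_inner_scale_left)
  qed
  then have rA: "(A_norm A r)\<^sup>2 = (\<Sum>j\<in>J. (c j)\<^sup>2)"
    by (simp add: A_norm_sq A)
  have "(\<Sum>j\<in>J. (c j)\<^sup>2) \<le> (\<Sum>j\<in>J. q\<^sup>2 * ((u - P u) \<bullet> ut j)\<^sup>2)"
  proof (rule sum_mono)
    fix j assume j: "j \<in> J"
    have "\<bar>c j\<bar> \<le> (q * \<bar>1 / lt j - 1 / lam\<bar>) * \<bar>c j\<bar>"
      using q(2)[of j] j mult_right_mono[of 1 "q * \<bar>1 / lt j - 1 / lam\<bar>" "\<bar>c j\<bar>"]
      by (simp add: J_def)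
    also have "\<dots> = q * \<bar>(1 / lam - 1 / lt j) * c j\<bar>"
      by (simp only: abs_mult abs_minus_commute[of "1 / lt j"] mult.assoc)
    also have "\<dots> = q * \<bar>(u - P u) \<bullet> ut j\<bar>"
      using j by (simp only: c_def ritz_coefficient_identity[OF A R u P] J_def DiffD1)
    finally have "\<bar>c j\<bar>\<^sup>2 \<le> (q * \<bar>(u - P u) \<bullet> ut j\<bar>)\<^sup>2"
      by (intro power_mono) auto
    then show "(c j)\<^sup>2 \<le> q\<^sup>2 * ((u - P u) \<bullet> ut j)\<^sup>2"
      by (simp add: power_mult_distrib)
  qed
  also have "\<dots> \<le> q\<^sup>2 * (1 / lt 1 * (norm (u - P u))\<^sup>2)"
    unfolding sum_distrib_left[symmetric]
    by (intro mult_left_mono Bessel_bounded_length orth len mu) (simp_all add: J_def)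
  finally have c: "(\<Sum>j\<in>J. (c j)\<^sup>2) \<le> 1 / lt 1 * q\<^sup>2 * (norm (u - P u))\<^sup>2"
    by (simp add: mult_ac)
  then show "(A_norm A (P u - E u))\<^sup>2 \<le> 1 / lt 1 * q\<^sup>2 * (norm (u - P u))\<^sup>2"
    using rA by (simp add: r_def)
  have "(norm r)\<^sup>2 \<le> 1 / lt 1 * (\<Sum>j\<in>J. (c j)\<^sup>2)"
    unfolding r by (intro norm_orthogonal_sum_sq_le orth len) (simp_all add: J_def)
  also have "\<dots> \<le> 1 / lt 1 * (1 / lt 1 * q\<^sup>2 * (norm (u - P u))\<^sup>2)"
    by (intro mult_left_mono c mu)
  also have "\<dots> = (1 / lt 1 * q * norm (u - P u))\<^sup>2"
    by (simp only: power_mult_distrib power2_eq_square mult_ac)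
  finally show "norm (P u - E u) \<le> 1 / lt 1 * q * norm (u - P u)"
    unfolding r_def by (rule power2_le_imp_le) (intro mult_nonneg_nonneg mu q(1) norm_ge_zero)
qed

section \<open>The error estimates\<close>

text \<open>The case \<open>q = 0\<close> arises only from an infinite gap, that is, an empty range of \<open>j\<close>.\<close>

lemma gap_reciprocal:
  assumes "0 < gap lt m i lam"
  obtains q where "0 \<le> q" "\<And>j. j \<in> {1..m} - {i} \<Longrightarrow> 1 \<le> q * \<bar>1 / lt j - 1 / lam\<bar>"
    and "\<And>a. real_of_ereal (ereal a / gap lt m i lam) = a * q"
    and "\<And>a. real_of_ereal (ereal a / (gap lt m i lam)\<^sup>2) = a * q\<^sup>2"
proof (cases "gap lt m i lam")
  case (real d)
  have d: "0 < d" using assms real by simp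
  have le: "d \<le> \<bar>1 / lt j - 1 / lam\<bar>" if "j \<in> {1..m} - {i}" for j
  proof -
    have "gap lt m i lam \<le> ereal \<bar>1 / lt j - 1 / lam\<bar>"
      unfolding gap_def using that by (rule INF_lower)
    then show ?thesis using real by simp
  qed
  show ?thesis
  proof (rule that[of "1 / d"])
    show "1 \<le> 1 / d * \<bar>1 / lt j - 1 / lam\<bar>" if "j \<in> {1..m} - {i}" for j
      using d le[OF that] by (simp add: field_simps)
  qed (use d real in \<open>simp_all add: power_divide\<close>)
next
  case PInf
  have "{1..m} - {i} = {}"
  proof (rule ccontr)
    assume "{1..m} - {i} \<noteq> {}"
    then obtain j where "j \<in> {1..m} - {i}" by blast
    then have "gap lt m i lam \<le> ereal \<bar>1 / lt j - 1 / lam\<bar>"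
      unfolding gap_def by (rule INF_lower)
    then show False using PInf by simp
  qed
  then have "1 \<le> 0 * \<bar>1 / lt j - 1 / lam\<bar>" if "j \<in> {1..m} - {i}" for j
    using that by blast
  then show ?thesis
    using PInf by (intro that[of 0]) (simp_all add: power2_eq_square)
next
  case MInf
  then show ?thesis using assms by simp
qed

theorem theorem3p1:
  fixes A :: "real^'n^'n" and K :: "(real^'n) set" and m i :: nat
    and lt :: "nat \<Rightarrow> real" and ut :: "nat \<Rightarrow> real^'n"
    and lam :: real and u :: "real^'n"
    and P E :: "real^'n \<Rightarrow> real^'n"
  assumes "spd_matrix A"
    and "subspace K" and "dim K = m"
    and "ritz_pairs A K m lt ut"
    and "eigenpair A lam u"
    and "i \<in> {1..m}"
    and "\<forall>j\<in>{1..m}. \<bar>1 / lt i - 1 / lam\<bar> \<le> \<bar>1 / lt j - 1 / lam\<bar>"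
    and "A_orthogonal_projection A K P"
    and "ritz_spectral_projection A (ut i) E"
    and "0 < gap lt m i lam"
  shows "A_norm A (u - E u)
           \<le> sqrt (1 + real_of_ereal (ereal (1 / lt 1) / (gap lt m i lam)\<^sup>2) * (eta A P)\<^sup>2)
              * A_norm A (u - P u)
       \<and> norm (u - E u)
           \<le> ((1 + real_of_ereal (ereal (1 / lt 1) / gap lt m i lam)) * eta A P) * A_norm A (u - E u)"
proof -
  note A = assms(1) and P = assms(8)
  obtain q where q: "0 \<le> q" "\<And>j. j \<in> {1..m} - {i} \<Longrightarrow> 1 \<le> q * \<bar>1 / lt j - 1 / lam\<bar>"
    and gap1: "\<And>a. real_of_ereal (ereal a / gap lt m i lam) = a * q"
    and gap2: "\<And>a. real_of_ereal (ereal a / (gap lt m i lam)\<^sup>2) = a * q\<^sup>2"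
    using gap_reciprocal[OF assms(10)] by blast
  define e where "e = u - P u"
  define r where "r = P u - E u"
  define \<mu> where "\<mu> = 1 / lt 1"
  define \<eta> where "\<eta> = eta A P"
  have w: "u - E u = e + r" by (simp add: e_def r_def)
  have rA: "(A_norm A r)\<^sup>2 \<le> \<mu> * q\<^sup>2 * (norm e)\<^sup>2" and r2: "norm r \<le> \<mu> * q * norm e"
    unfolding r_def e_def \<mu>_def using ritz_remainder_bounds[OF assms(1-6,8,9) q] by simp_all
  have \<mu>: "0 \<le> \<mu>"
    using assms(6) ritz_value_pos[OF assms(4), of 1] by (simp add: \<mu>_def)
  have \<eta>: "0 \<le> \<eta>"
    unfolding \<eta>_def by (rule eta_nonneg[OF A P])
  have e2: "norm e \<le> \<eta> * A_norm A e"
    unfolding e_def \<eta>_def by (rule Aubin_Nitsche[OF A P])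
  have "r \<in> K"
  proof -
    have "span {ut i} \<subseteq> K"
      using assms(2,4,6) by (intro span_minimal) (auto simp: ritz_pairs_def)
    then show ?thesis
      unfolding r_def using assms(2,9) P
      by (intro subspace_diff) (auto simp: ritz_spectral_projection_def A_orthogonal_projection_def)
  qed
  then have orth: "A_inner A e r = 0"
    unfolding e_def by (rule A_projection_error_orthogonal[OF P])
  have "(A_norm A (e + r))\<^sup>2 \<le> (A_norm A e)\<^sup>2 + \<mu> * q\<^sup>2 * (norm e)\<^sup>2"
    using rA by (simp add: A_pythagoras A orth)
  also have "\<dots> \<le> (A_norm A e)\<^sup>2 + \<mu> * q\<^sup>2 * (\<eta> * A_norm A e)\<^sup>2"
    using e2 \<mu> by (intro add_left_mono mult_left_mono power_mono) auto
  also have "\<dots> = (1 + \<mu> * q\<^sup>2 * \<eta>\<^sup>2) * (A_norm A e)\<^sup>2"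
    by (simp add: algebra_simps power_mult_distrib)
  finally have "A_norm A (e + r) \<le> sqrt (1 + \<mu> * q\<^sup>2 * \<eta>\<^sup>2) * A_norm A e"
    using A_norm_nonneg[OF A, of e] real_le_rsqrt by (metis real_sqrt_mult real_sqrt_unique)
  moreover have "norm (e + r) \<le> (1 + \<mu> * q) * \<eta> * A_norm A (e + r)"
  proof -
    have "norm (e + r) \<le> (1 + \<mu> * q) * norm e"
      using norm_triangle_ineq[of e r] r2 by (simp add: distrib_right)
    also have "\<dots> \<le> (1 + \<mu> * q) * (\<eta> * A_norm A (e + r))"
    proof (rule mult_left_mono)
      show "norm e \<le> \<eta> * A_norm A (e + r)"
        using e2 mult_left_mono[OF A_norm_le_add_orthogonal[OF A orth] \<eta>] by linarith
    qed (simp add: \<mu> q(1))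
    finally show ?thesis by (simp add: mult.assoc)
  qed
  ultimately show ?thesis
    unfolding w gap1 gap2 by (simp add: \<mu>_def \<eta>_def e_def)
qed

end
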